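(* (Strong maximum principle) Let $\Omega\subset\mathbb{R}^n$ be open and connected. Let $F(x,s,p,M)$ be continuous on $\Omega\times\mathbb{R}\times\mathbb{R}^n\times\mathcal{S}^{n\times n}$ and of class $C^1$ in $(s,p,M)$, and elliptic: the matrix $\big(\frac{\partial F}{\partial M_{ij}}\big)$ is positive definite for all values of the arguments. Let $u\in LSC(\Omega)$ and $v\in C^2(\Omega)$ satisfy $u\ge v$ in $\Omega$ and $$F(x,u,\nabla u,\nabla^2u)\le F(x,v,\nabla v,\nabla^2v)\quad\text{in }\Omega\text{ in the viscosity sense}.$$ Suppose $u=v$ at some point in $\Omega$. Then $u\equiv v$ in $\Omega$.
   Context: $\mathcal{S}^{n\times n}$ is the set of real symmetric $n\times n$ matrices; $LSC(\Omega)$ is the set of lower-semicontinuous functions on $\Omega$. "Of class $C^1$ in $(s,p,M)$" means that the partial derivatives of $F$ in $(s,p,M)$ exist and are continuous functions of $(x,s,p,M)$. No uniform ellipticity and no uniform bound on $|F_s|,|F_{p_i}|$ is assumed. Viscosity sense: whenever $x_0\in\Omega$ and $\varphi$ is $C^2$ near $x_0$ with $\varphi\le u$ near $x_0$ and $\varphi(x_0)=u(x_0)$, one has $F(x_0,\varphi(x_0),\nabla\varphi(x_0),\nabla^2\varphi(x_0))\le F(x_0,v(x_0),\nabla v(x_0),\nabla^2v(x_0))$. *)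

theory Defs
  imports "HOL-Analysis.Analysis"
begin

definition sym_mats :: "(real^'n^'n) set" where
  "sym_mats = {M. transpose M = M}"

definition pos_def_mat :: "real^'n^'n \<Rightarrow> bool" where
  "pos_def_mat A \<longleftrightarrow> transpose A = A \<and> (\<forall>\<xi>. \<xi> \<noteq> 0 \<longrightarrow> \<xi> \<bullet> (A *v \<xi>) > 0)"

definition lsc_on :: "'a::topological_space set \<Rightarrow> ('a \<Rightarrow> real) \<Rightarrow> bool" where
  "lsc_on \<Omega> u \<longleftrightarrow> (\<forall>c. openin (top_of_set \<Omega>) {x \<in> \<Omega>. c < u x})"

definition grad :: "(real^'n \<Rightarrow> real) \<Rightarrow> real^'n \<Rightarrow> real^'n" where
  "grad f x = (\<chi> i. frechet_derivative f (at x) (axis i 1))"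

definition hess :: "(real^'n \<Rightarrow> real) \<Rightarrow> real^'n \<Rightarrow> real^'n^'n" where
  "hess f x = jacobian (grad f) (at x)"

(* Only meant for open U, where differentiability within U and at a point of U agree. *)
definition C2_on :: "(real^'n) set \<Rightarrow> (real^'n \<Rightarrow> real) \<Rightarrow> bool" where
  "C2_on U f \<longleftrightarrow>
     f differentiable_on U \<and> grad f differentiable_on U \<and> continuous_on U (hess f)"

(* An operator F(x,s,p,M) takes arbitrary square matrices as last argument, but only its
   values at symmetric M, for x in Omega, are ever used. *)
type_synonym 'n operator =
  "real^'n \<Rightarrow> real \<Rightarrow> real^'n \<Rightarrow> real^'n^'n \<Rightarrow> real"

definition op_dom :: "(real^'n) set \<Rightarrow> ((real^'n) \<times> real \<times> (real^'n) \<times> (real^'n^'n)) set" where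
  "op_dom \<Omega> = \<Omega> \<times> UNIV \<times> UNIV \<times> sym_mats"

(* (E_ij + E_ji) / 2, where E_ij are the matrix units; equal to E_ii if i = j. *)
definition sym_unit :: "'n \<Rightarrow> 'n \<Rightarrow> real^'n^'n" where
  "sym_unit i j = (\<chi> k l. ((if k = i \<and> l = j then 1 else 0) +
                           (if k = j \<and> l = i then 1 else 0)) / 2)"

definition F_s :: "'n operator \<Rightarrow> real^'n \<Rightarrow> real \<Rightarrow> real^'n \<Rightarrow> real^'n^'n \<Rightarrow> real" where
  "F_s F x s p M = deriv (\<lambda>t. F x t p M) s"

definition F_p :: "'n operator \<Rightarrow> real^'n \<Rightarrow> real \<Rightarrow> real^'n \<Rightarrow> real^'n^'n \<Rightarrow> real^'n" where
  "F_p F x s p M = (\<chi> i. deriv (\<lambda>t. F x s (p + t *\<^sub>R axis i 1) M) 0)"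

(* As F lives on symmetric matrices, the (i,j) derivative is taken along sym_unit i j.  This is
   the usual normalisation of dF/dM_ij, for which the differential of F in M in a symmetric
   direction N is the sum over all i, j of dF/dM_ij * N_ij (so that F(M) = tr (A M) with A
   symmetric has derivative matrix A). *)
definition F_M :: "'n operator \<Rightarrow> real^'n \<Rightarrow> real \<Rightarrow> real^'n \<Rightarrow> real^'n^'n \<Rightarrow> real^'n^'n" where
  "F_M F x s p M = (\<chi> i j. deriv (\<lambda>t. F x s p (M + t *\<^sub>R sym_unit i j)) 0)"

definition C1_in_spM :: "(real^'n) set \<Rightarrow> 'n operator \<Rightarrow> bool" where
  "C1_in_spM \<Omega> F \<longleftrightarrow>
     (\<forall>(x, s, p, M) \<in> op_dom \<Omega>.
        (\<lambda>t. F x t p M) field_differentiable (at s) \<and>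
        (\<forall>i. (\<lambda>t. F x s (p + t *\<^sub>R axis i 1) M) field_differentiable (at 0)) \<and>
        (\<forall>i j. (\<lambda>t. F x s p (M + t *\<^sub>R sym_unit i j)) field_differentiable (at 0))) \<and>
     continuous_on (op_dom \<Omega>) (\<lambda>(x, s, p, M). F_s F x s p M) \<and>
     continuous_on (op_dom \<Omega>) (\<lambda>(x, s, p, M). F_p F x s p M) \<and>
     continuous_on (op_dom \<Omega>) (\<lambda>(x, s, p, M). F_M F x s p M)"

definition elliptic :: "(real^'n) set \<Rightarrow> 'n operator \<Rightarrow> bool" where
  "elliptic \<Omega> F \<longleftrightarrow> (\<forall>(x, s, p, M) \<in> op_dom \<Omega>. pos_def_mat (F_M F x s p M))"

(* F(x,u,Du,D^2u) <= F(x,v,Dv,D^2v) in Omega in the viscosity sense; only u is tested. *)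
definition viscosity_le ::
    "(real^'n) set \<Rightarrow> 'n operator \<Rightarrow> (real^'n \<Rightarrow> real) \<Rightarrow> (real^'n \<Rightarrow> real) \<Rightarrow> bool" where
  "viscosity_le \<Omega> F u v \<longleftrightarrow>
     (\<forall>x0 \<in> \<Omega>. \<forall>\<phi>.
        (\<exists>U. open U \<and> x0 \<in> U \<and> U \<subseteq> \<Omega> \<and> C2_on U \<phi> \<and> (\<forall>x\<in>U. \<phi> x \<le> u x)) \<and>
        \<phi> x0 = u x0 \<longrightarrow>
        F x0 (\<phi> x0) (grad \<phi> x0) (hess \<phi> x0) \<le> F x0 (v x0) (grad v x0) (hess v x0))"

end

theory Submission
  imports Defs
begin

text \<open>
  The coincidence set $Z = \{x \in \Omega \mid u(x) = v(x)\}$ is relatively closed, because $u - v \ge 0$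
  is lower semicontinuous.  If $Z$ is neither empty nor all of $\Omega$, connectedness yields a ball
  whose interior avoids $Z$ but which has a point $x_0 \in Z$ on its boundary (\<open>touching_ball\<close>).
  The contradiction at $x_0$ is a Hopf-type argument (\<open>hopf_no_touching\<close>).

  Let $L$ be the linearisation of $F$ at the 2-jet of $v$ at $x_0$.  There is a smooth barrier $h$ with
  $h(x_0) = 0$ and $L h(x_0) > 0$, which near $x_0$ is nonnegative only at $x_0$ and inside the ball; this is where
  ellipticity enters, through a large multiple of the positive number $e \cdot F_M e$, with $e$ the
  inward normal.  Minimise $u - v - \varepsilon h$ over a small closed ball $K$ around $x_0$.  The
  minimum is at most the value $0$ taken at $x_0$.  On the sphere $\partial K$ the function is
  positive: where $h \ge 0$, the lower semicontinuous function $u - v$ has a positive minimum, which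
  beats $\varepsilon h$ for small $\varepsilon$; where $h < 0$, one has $u - v \ge 0 > \varepsilon h$.
  Hence the minimum $m$ is attained at an interior point $y$, and $\varphi = v + \varepsilon h + m$ touches
  $u$ from below there.  So $F$ at the jet of $\varphi$ is at most $F$ at the jet of $v$.

  The linearisation of $F$ says the opposite.  The jets of $\varphi$ and $v$ at $y$ differ by
  $(\tau, \varepsilon \nabla h, \varepsilon \nabla^2 h)$ with $0 \le \tau = u(y) - v(y) \le \varepsilon h(y)$, so the
  zeroth-order term is at most $\varepsilon |F_s| h(y)$, whatever the sign of $F_s$, and $h(y)$ is
  small.  Up to an error that is small compared with $\varepsilon$ (\<open>operator_linearisation\<close>), the
  difference of the values of $F$ is therefore at least $\varepsilon (F_p \cdot \nabla h + \mathrm{tr}(F_M \nabla^2 h))$,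
  which is bounded below by a positive multiple of $\varepsilon$.  Everything happens near one
  single jet, so that continuity replaces uniform ellipticity and uniform bounds.
\<close>

section \<open>Gradients, second derivatives and their symmetry\<close>

text \<open>
  Schwarz's theorem in the plane.  The second difference of $G$ over a square of side $h$ equals
  $h^2$ times either mixed partial at some point of the square, by applying the mean value theorem in
  the two possible orders; then $h$ is sent to $0$.
\<close>

lemma mixed_partials_commute:
  fixes G Gs Gt Gst Gts :: "real \<Rightarrow> real \<Rightarrow> real"
  assumes r: "r > 0"
    and Gs: "\<And>s t. \<bar>s\<bar> < r \<Longrightarrow> \<bar>t\<bar> < r \<Longrightarrow> ((\<lambda>s. G s t) has_real_derivative Gs s t) (at s)"
    and Gt: "\<And>s t. \<bar>s\<bar> < r \<Longrightarrow> \<bar>t\<bar> < r \<Longrightarrow> ((\<lambda>t. G s t) has_real_derivative Gt s t) (at t)"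
    and Gst: "\<And>s t. \<bar>s\<bar> < r \<Longrightarrow> \<bar>t\<bar> < r \<Longrightarrow> ((\<lambda>t. Gs s t) has_real_derivative Gst s t) (at t)"
    and Gts: "\<And>s t. \<bar>s\<bar> < r \<Longrightarrow> \<bar>t\<bar> < r \<Longrightarrow> ((\<lambda>s. Gt s t) has_real_derivative Gts s t) (at s)"
    and cont: "continuous (at (0,0)) (\<lambda>(s,t). Gst s t)" "continuous (at (0,0)) (\<lambda>(s,t). Gts s t)"
  shows "Gst 0 0 = Gts 0 0"
proof (rule ccontr)
  assume "Gst 0 0 \<noteq> Gts 0 0"
  then have \<epsilon>: "\<bar>Gst 0 0 - Gts 0 0\<bar> / 2 > 0" (is "?\<epsilon> > 0") by simp
  obtain d1 where d1: "d1 > 0" "\<And>s t. dist (s,t) (0,0) < d1 \<Longrightarrow> \<bar>Gst s t - Gst 0 0\<bar> < ?\<epsilon>"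
    using cont(1)[unfolded continuous_at_eps_delta, rule_format, OF \<epsilon>] by (auto simp: dist_real_def)
  obtain d2 where d2: "d2 > 0" "\<And>s t. dist (s,t) (0,0) < d2 \<Longrightarrow> \<bar>Gts s t - Gts 0 0\<bar> < ?\<epsilon>"
    using cont(2)[unfolded continuous_at_eps_delta, rule_format, OF \<epsilon>] by (auto simp: dist_real_def)
  define h where "h = min r (min d1 d2) / 2"
  have h: "0 < h" "h < r" "h + h \<le> d1" "h + h \<le> d2"
    using r d1(1) d2(1) by (auto simp: h_def min_def)
  have near: "dist (s,t) (0,0) < d1" "dist (s,t) (0,0) < d2" if "0 < s" "s < h" "0 < t" "t < h" for s t :: real
  proof -
    have "dist (s,t) (0,0) \<le> \<bar>s\<bar> + \<bar>t\<bar>"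
      using sqrt_sum_squares_le_sum_abs[of s t] by (simp add: dist_prod_def dist_real_def)
    then show "dist (s,t) (0,0) < d1" "dist (s,t) (0,0) < d2" using that h by auto
  qed
  have "\<exists>\<sigma>>0. \<sigma> < h \<and> (G h h - G h 0) - (G 0 h - G 0 0) = (h - 0) * (Gs \<sigma> h - Gs \<sigma> 0)"
    by (rule MVT2) (use h in \<open>auto intro!: DERIV_diff Gs\<close>)
  then obtain \<sigma> where \<sigma>: "0 < \<sigma>" "\<sigma> < h"
    "(G h h - G h 0) - (G 0 h - G 0 0) = (h - 0) * (Gs \<sigma> h - Gs \<sigma> 0)" by blast
  have "\<exists>\<tau>>0. \<tau> < h \<and> Gs \<sigma> h - Gs \<sigma> 0 = (h - 0) * Gst \<sigma> \<tau>"
    by (rule MVT2) (use h \<sigma> in \<open>auto intro!: Gst\<close>)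
  then obtain \<tau> where \<tau>: "0 < \<tau>" "\<tau> < h" "Gs \<sigma> h - Gs \<sigma> 0 = (h - 0) * Gst \<sigma> \<tau>"
    by blast
  have "\<exists>\<tau>'>0. \<tau>' < h \<and> (G h h - G 0 h) - (G h 0 - G 0 0) = (h - 0) * (Gt h \<tau>' - Gt 0 \<tau>')"
    by (rule MVT2) (use h in \<open>auto intro!: DERIV_diff Gt\<close>)
  then obtain \<tau>' where \<tau>': "0 < \<tau>'" "\<tau>' < h"
    "(G h h - G 0 h) - (G h 0 - G 0 0) = (h - 0) * (Gt h \<tau>' - Gt 0 \<tau>')" by blast
  have "\<exists>\<sigma>'>0. \<sigma>' < h \<and> Gt h \<tau>' - Gt 0 \<tau>' = (h - 0) * Gts \<sigma>' \<tau>'"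
    by (rule MVT2) (use h \<tau>' in \<open>auto intro!: Gts\<close>)
  then obtain \<sigma>' where \<sigma>': "0 < \<sigma>'" "\<sigma>' < h" "Gt h \<tau>' - Gt 0 \<tau>' = (h - 0) * Gts \<sigma>' \<tau>'"
    by blast
  have "(G h h - G h 0) - (G 0 h - G 0 0) = h * (h * Gst \<sigma> \<tau>)"
    using \<sigma>(3) \<tau>(3) by simp
  moreover have "(G h h - G 0 h) - (G h 0 - G 0 0) = h * (h * Gts \<sigma>' \<tau>')"
    using \<tau>'(3) \<sigma>'(3) by simp
  ultimately have "h * (h * Gst \<sigma> \<tau>) = h * (h * Gts \<sigma>' \<tau>')" by linarith
  then have "Gst \<sigma> \<tau> = Gts \<sigma>' \<tau>'" using h by simp
  moreover have "\<bar>Gst \<sigma> \<tau> - Gst 0 0\<bar> < ?\<epsilon>" "\<bar>Gts \<sigma>' \<tau>' - Gts 0 0\<bar> < ?\<epsilon>"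
    using d1(2) d2(2) near \<sigma> \<tau> \<sigma>' \<tau>' by blast+
  ultimately show False by (auto simp: abs_if field_simps split: if_splits)
qed

lemma has_derivative_grad:
  fixes f :: "real^'n \<Rightarrow> real"
  assumes "f differentiable (at x)"
  shows "(f has_derivative (\<lambda>y. grad f x \<bullet> y)) (at x)"
proof -
  let ?D = "frechet_derivative f (at x)"
  have D: "(f has_derivative ?D) (at x)" using assms frechet_derivative_works by blast
  then interpret linear ?D by (rule has_derivative_linear)
  have "?D = (\<lambda>y. grad f x \<bullet> y)"
  proof
    fix y
    have "?D y = ?D (\<Sum>i\<in>UNIV. y$i *\<^sub>R axis i 1)"
      using basis_expansion[of y] by (simp add: scalar_mult_eq_scaleR)
    also have "\<dots> = (\<Sum>i\<in>UNIV. y$i * ?D (axis i 1))" by (simp add: sum scale)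
    also have "\<dots> = grad f x \<bullet> y" by (simp add: grad_def inner_vec_def mult.commute)
    finally show "?D y = grad f x \<bullet> y" .
  qed
  then show ?thesis using D by simp
qed

lemma has_derivative_hess:
  assumes "grad f differentiable (at x)"
  shows "(grad f has_derivative (\<lambda>y. hess f x *v y)) (at x)"
  using assms jacobian_works unfolding hess_def by blast

lemma grad_eqI:
  fixes f :: "real^'n \<Rightarrow> real"
  assumes "(f has_derivative (\<lambda>y. g \<bullet> y)) (at x)"
  shows "grad f x = g"
  using frechet_derivative_at[OF assms, symmetric] by (simp add: grad_def vec_eq_iff inner_axis)

lemma hess_eqI:
  assumes "(grad f has_derivative (\<lambda>y. H *v y)) (at x)"
  shows "hess f x = H"
  using frechet_derivative_at[OF assms, symmetric]
  by (simp add: hess_def jacobian_def)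

lemma C2_on_derivatives:
  assumes "C2_on U f" "open U" "x \<in> U"
  shows "(f has_derivative (\<lambda>y. grad f x \<bullet> y)) (at x)"
    and "(grad f has_derivative (\<lambda>y. hess f x *v y)) (at x)"
  using assms has_derivative_grad[of f x] has_derivative_hess[of f x]
  by (simp_all add: C2_on_def differentiable_on_eq_differentiable_at)

text \<open>
  The second derivative may be computed from any candidate gradient field \<open>g\<close>, although \<open>hess\<close> is
  defined through \<open>grad f\<close>: the two fields agree on an open set.
\<close>

lemma C2_onI:
  fixes f :: "real^'n \<Rightarrow> real"
  assumes U: "open U"
    and f: "\<And>x. x \<in> U \<Longrightarrow> (f has_derivative (\<lambda>y. g x \<bullet> y)) (at x)"
    and g: "\<And>x. x \<in> U \<Longrightarrow> (g has_derivative (\<lambda>y. H x *v y)) (at x)"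
    and H: "continuous_on U H"
  shows "C2_on U f" and "\<And>x. x \<in> U \<Longrightarrow> grad f x = g x" and "\<And>x. x \<in> U \<Longrightarrow> hess f x = H x"
proof -
  show gr: "grad f x = g x" if "x \<in> U" for x using grad_eqI[OF f[OF that]] .
  have gd: "(grad f has_derivative (\<lambda>y. H x *v y)) (at x)" if "x \<in> U" for x
    using has_derivative_transform_within_open[OF g[OF that] U that] gr by simp
  show he: "hess f x = H x" if "x \<in> U" for x using hess_eqI[OF gd[OF that]] .
  have "continuous_on U (hess f)" using H he by (simp cong: continuous_on_cong)
  then show "C2_on U f"
    unfolding C2_on_def differentiable_on_eq_differentiable_at[OF U] differentiable_def
    using f gd by blast
qed

text \<open>
  Restriction of $f$ to the plane through $x$ in two coordinate directions.  This lemma is what places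
  the jets of $v$ in the domain of the operator, where only symmetric matrices occur.
\<close>

lemma hess_symmetric:
  fixes f :: "real^'n \<Rightarrow> real"
  assumes C2: "C2_on U f" and U: "open U" and x: "x \<in> U"
  shows "hess f x \<in> sym_mats"
proof -
  have "hess f x $ i $ j = hess f x $ j $ i" for i j
  proof -
    obtain \<rho> where \<rho>: "\<rho> > 0" "ball x \<rho> \<subseteq> U" using U x openE by blast
    let ?p = "\<lambda>s t. x + s *\<^sub>R axis i 1 + t *\<^sub>R (axis j 1 :: real^'n)"
    have inU: "?p s t \<in> U" if "\<bar>s\<bar> < \<rho>/2" "\<bar>t\<bar> < \<rho>/2" for s t
    proof -
      have "norm (s *\<^sub>R axis i 1 + t *\<^sub>R (axis j 1 :: real^'n)) \<le> \<bar>s\<bar> + \<bar>t\<bar>"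
        by (rule norm_triangle_le) simp
      moreover have "dist x (?p s t) = norm (s *\<^sub>R axis i 1 + t *\<^sub>R (axis j 1 :: real^'n))"
        by (subst dist_commute) (simp add: dist_norm add.assoc)
      ultimately have "dist x (?p s t) < \<rho>" using that by simp
      then show ?thesis using \<rho> by auto
    qed
    note D = C2_on_derivatives[OF C2 U]
    have ds: "((\<lambda>s. ?p s t) has_derivative (\<lambda>r. r *\<^sub>R axis i 1)) (at s)"
     and dt: "((\<lambda>t. ?p s t) has_derivative (\<lambda>r. r *\<^sub>R axis j 1)) (at t)" for s t
      by (auto intro!: derivative_eq_intros)
    have fd: "((\<lambda>a. f (\<gamma> a)) has_real_derivative grad f (\<gamma> a) $ k) (at a)"
      and gd: "((\<lambda>a. grad f (\<gamma> a) $ l) has_real_derivative hess f (\<gamma> a) $ l $ k) (at a)"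
      if "\<gamma> a \<in> U" "(\<gamma> has_derivative (\<lambda>r. r *\<^sub>R axis k 1)) (at a)" for \<gamma> a k l
    proof -
      show "((\<lambda>a. f (\<gamma> a)) has_real_derivative grad f (\<gamma> a) $ k) (at a)"
        unfolding has_field_derivative_def
        by (rule has_derivative_eq_rhs[OF has_derivative_compose[OF that(2) D(1)[OF that(1)]]])
          (simp add: fun_eq_iff inner_axis)
      have "((\<lambda>a. grad f (\<gamma> a)) has_derivative (\<lambda>r. hess f (\<gamma> a) *v (r *\<^sub>R axis k 1))) (at a)"
        using has_derivative_compose[OF that(2) D(2)[OF that(1)]] .
      then have "((\<lambda>a. grad f (\<gamma> a) $ l) has_derivative (\<lambda>r. (hess f (\<gamma> a) *v (r *\<^sub>R axis k 1)) $ l)) (at a)"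
        by (rule bounded_linear.has_derivative[OF bounded_linear_vec_nth])
      moreover have "(hess f (\<gamma> a) *v (r *\<^sub>R axis k 1)) $ l = hess f (\<gamma> a) $ l $ k * r" for r
        by (simp add: matrix_vector_mult_basis column_def matrix_vector_mult_scaleR)
      ultimately show "((\<lambda>a. grad f (\<gamma> a) $ l) has_real_derivative hess f (\<gamma> a) $ l $ k) (at a)"
        unfolding has_field_derivative_def by simp
    qed
    have hc: "continuous (at (0,0)) (\<lambda>(s,t). hess f (?p s t) $ k $ l)" for k l
    proof -
      have "isCont (hess f) x" using C2 U x by (simp add: C2_on_def continuous_on_eq_continuous_at)
      then have "isCont (hess f) (?p (fst (0,0)) (snd (0,0)))" by simp
      moreover have "isCont (\<lambda>a::real\<times>real. ?p (fst a) (snd a)) (0,0)" by (intro continuous_intros)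
      ultimately have "isCont (\<lambda>a::real\<times>real. hess f (?p (fst a) (snd a))) (0,0)"
        using isCont_o2[of "(0,0)" "\<lambda>a. ?p (fst a) (snd a)" "hess f"] by simp
      then show ?thesis
        by (auto simp: case_prod_unfold intro!: continuous_intros)
    qed
    have "hess f (?p 0 0) $ i $ j = hess f (?p 0 0) $ j $ i"
    proof (rule mixed_partials_commute[where r="\<rho>/2" and G="\<lambda>s t. f (?p s t)"
            and Gs="\<lambda>s t. grad f (?p s t) $ i" and Gt="\<lambda>s t. grad f (?p s t) $ j"
            and Gst="\<lambda>s t. hess f (?p s t) $ i $ j" and Gts="\<lambda>s t. hess f (?p s t) $ j $ i"])
      fix s t :: real assume st: "\<bar>s\<bar> < \<rho>/2" "\<bar>t\<bar> < \<rho>/2"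
      show "((\<lambda>s. f (?p s t)) has_real_derivative grad f (?p s t) $ i) (at s)"
        by (rule fd[OF inU[OF st] ds])
      show "((\<lambda>t. f (?p s t)) has_real_derivative grad f (?p s t) $ j) (at t)"
        by (rule fd[OF inU[OF st] dt])
      show "((\<lambda>t. grad f (?p s t) $ i) has_real_derivative hess f (?p s t) $ i $ j) (at t)"
        by (rule gd[OF inU[OF st] dt])
      show "((\<lambda>s. grad f (?p s t) $ j) has_real_derivative hess f (?p s t) $ j $ i) (at s)"
        by (rule gd[OF inU[OF st] ds])
    qed (use \<rho>(1) hc in auto)
    then show ?thesis by simp
  qed
  then show ?thesis by (simp add: sym_mats_def transpose_def vec_eq_iff)
qed

section \<open>Lower semicontinuous functions\<close>

lemma lsc_on_subset:
  assumes u: "lsc_on S u" and T: "T \<subseteq> S"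
  shows "lsc_on T u"
  unfolding lsc_on_def
proof
  fix c
  obtain W where W: "open W" "{x \<in> S. c < u x} = S \<inter> W"
    using u unfolding lsc_on_def openin_open by blast
  then have "{x \<in> T. c < u x} = T \<inter> W" using T by blast
  then show "openin (top_of_set T) {x \<in> T. c < u x}" using W(1) by (simp add: openin_open_Int)
qed

text \<open>
  The superlevel set of a difference is the union over all thresholds $q$ of
  $\{q < u\} \cap \{g < q - c\}$.
\<close>

lemma lsc_on_diff_continuous:
  assumes u: "lsc_on S u" and g: "continuous_on S g"
  shows "lsc_on S (\<lambda>x. u x - g x)"
  unfolding lsc_on_def
proof
  fix c
  have eq: "{x \<in> S. c < u x - g x} = (\<Union>q. {x \<in> S. q < u x} \<inter> (S \<inter> g -` {..< q - c}))"
  proof (intro equalityI subsetI)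
    fix x assume "x \<in> {x \<in> S. c < u x - g x}"
    moreover from this obtain q where "c + g x < q" "q < u x"
      using dense[of "c + g x" "u x"] by auto
    ultimately show "x \<in> (\<Union>q. {x \<in> S. q < u x} \<inter> (S \<inter> g -` {..< q - c}))" by force
  qed auto
  have "openin (top_of_set S) (S \<inter> g -` {..< q - c})" for q
    by (rule continuous_openin_preimage_gen[OF g]) simp
  then have "openin (top_of_set S) ({x \<in> S. q < u x} \<inter> (S \<inter> g -` {..< q - c}))" for q
    by (rule openin_Int[rotated]) (use u in \<open>simp add: lsc_on_def\<close>)
  then show "openin (top_of_set S) {x \<in> S. c < u x - g x}"
    unfolding eq by (intro openin_Union) blast
qed

text \<open>
  Without a minimum, the relatively open sets $\{u > u(y)\}$, $y \in K$, would cover $K$; the point $y$ of least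
  value in a finite subcover is not covered.
\<close>

lemma lsc_on_attains_min:
  fixes u :: "'a::topological_space \<Rightarrow> real"
  assumes "lsc_on K u" "compact K" "K \<noteq> {}"
  obtains x where "x \<in> K" "\<And>y. y \<in> K \<Longrightarrow> u x \<le> u y"
proof -
  have "\<exists>x\<in>K. \<forall>y\<in>K. u x \<le> u y"
  proof (rule ccontr)
    assume no: "\<not> ?thesis"
    have "\<exists>T. open T \<and> {x \<in> K. u y < u x} = K \<inter> T" for y
      using assms(1) unfolding lsc_on_def openin_open by blast
    then obtain T where T: "\<And>y. open (T y)" "\<And>y. {x \<in> K. u y < u x} = K \<inter> T y" by metis
    have "K \<subseteq> (\<Union>y\<in>K. T y)"
    proof
      fix x assume "x \<in> K"
      then obtain y where "y \<in> K" "u y < u x" using no by force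
      then show "x \<in> (\<Union>y\<in>K. T y)" using T(2)[of y] \<open>x \<in> K\<close> by blast
    qed
    then obtain C where C: "C \<subseteq> K" "finite C" "K \<subseteq> (\<Union>y\<in>C. T y)"
      by (rule compactE_image[OF assms(2) T(1)])
    then have "C \<noteq> {}" using assms(3) by auto
    then obtain y0 where y0: "y0 \<in> C" "\<And>y. y \<in> C \<Longrightarrow> u y0 \<le> u y"
      using ex_min_if_finite[of "u ` C"] C(2) by (force simp: not_less)
    then obtain y where "y \<in> C" "y0 \<in> T y" using C by blast
    then have "u y < u y0" using T(2)[of y] y0(1) C(1) by blast
    then show False using y0(2)[OF \<open>y \<in> C\<close>] by simp
  qed
  then show ?thesis using that by blast
qed

section \<open>Touching balls\<close>

text \<open>
  A point of $Z$ which is not interior to $Z$ has points $x_1 \notin Z$ arbitrarily close to it, compared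
  with its distance to the complement of $\Omega$.  The ball around such an $x_1$ reaching to the nearest
  point of $Z$ then stays in $\Omega$.
\<close>

lemma touching_ball:
  fixes \<Omega> Z :: "'a::euclidean_space set"
  assumes "open \<Omega>" "connected \<Omega>" and Z: "closedin (top_of_set \<Omega>) Z" "Z \<noteq> {}" "Z \<noteq> \<Omega>"
  obtains x1 x\<^sub>0 where "x\<^sub>0 \<in> Z" "x1 \<noteq> x\<^sub>0" "ball x1 (dist x1 x\<^sub>0) \<subseteq> \<Omega> - Z"
proof -
  have Zsub: "Z \<subseteq> \<Omega>" using closedin_subset[OF Z(1)] by simp
  have "\<not> openin (top_of_set \<Omega>) Z"
    using assms connected_clopen by blast
  then have "\<not> open Z" using Zsub openin_open_eq[OF \<open>open \<Omega>\<close>] by blast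
  then obtain z where z: "z \<in> Z" "\<And>r. r > 0 \<Longrightarrow> \<not> ball z r \<subseteq> Z"
    unfolding open_contains_ball by blast
  obtain R where R: "R > 0" "ball z R \<subseteq> \<Omega>" using z(1) Zsub \<open>open \<Omega>\<close> openE by blast
  obtain x1 where x1: "x1 \<in> ball z (R/3)" "x1 \<notin> Z" using z(2)[of "R/3"] R(1) by fastforce
  obtain T where T: "closed T" "Z = \<Omega> \<inter> T" using Z(1) by (auto simp: closedin_closed)
  \<comment> \<open>nearest points are taken in a closed ball inside $\Omega$, as $Z$ itself need not be closed in the whole space\<close>
  have "cball z (2*R/3) \<inter> T \<subseteq> \<Omega>" using R by (force simp: subset_eq)
  then have eq: "cball z (2*R/3) \<inter> T = cball z (2*R/3) \<inter> Z" using T(2) by blast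
  have "closed (cball z (2*R/3) \<inter> T)" using T(1) by auto
  moreover have "cball z (2*R/3) \<inter> T \<noteq> {}" using z(1) R(1) T(2) by force
  ultimately obtain x0 where x0: "x0 \<in> cball z (2*R/3) \<inter> T"
    and min: "\<And>y. y \<in> cball z (2*R/3) \<inter> T \<Longrightarrow> dist x1 x0 \<le> dist x1 y"
    using distance_attains_inf[of "cball z (2*R/3) \<inter> T" x1] by metis
  have zin: "z \<in> cball z (2*R/3) \<inter> T" using z(1) R(1) T(2) by simp
  have le: "dist x1 x0 < R/3" using min[OF zin] x1(1) by (simp add: dist_commute)
  have "y \<in> \<Omega> - Z" if "y \<in> ball x1 (dist x1 x0)" for y
  proof -
    have "dist z y \<le> dist z x1 + dist x1 y" by (rule dist_triangle)
    then have y: "dist z y < 2*R/3" using that le x1(1) by simp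
    then have "y \<in> \<Omega>" using R by (auto simp: subset_eq)
    moreover have "y \<notin> T" using min[of y] y that by auto
    ultimately show ?thesis using T(2) by blast
  qed
  moreover have "x0 \<in> Z" using x0 eq by blast
  moreover have "x1 \<noteq> x0" using x1(2) \<open>x0 \<in> Z\<close> by blast
  ultimately show ?thesis using that by blast
qed

section \<open>Linearisation of the operator\<close>

text \<open>
  One direction is changed at a time: along each leg of the resulting path the one-variable mean
  value inequality compares \<open>f\<close> with the linear function of slope \<open>c k\<close>.  The set \<open>S\<close> only has to
  contain the coordinate box spanned by the increments, and the directions need not be independent,
  which makes the lemma applicable to the symmetric matrix units.
\<close>

lemma increment_along_directions:
  fixes f :: "'b::real_normed_vector \<Rightarrow> real" and d :: "'k \<Rightarrow> 'b" and t c :: "'k \<Rightarrow> real"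
  assumes "finite J"
    and slope: "\<And>w k. w \<in> S \<Longrightarrow> k \<in> J \<Longrightarrow>
           \<exists>g. ((\<lambda>r. f (w + r *\<^sub>R d k)) has_real_derivative g) (at 0) \<and> \<bar>g - c k\<bar> \<le> \<eta>"
    and box: "\<And>\<theta>. (\<And>k. k \<in> J \<Longrightarrow> \<bar>\<theta> k\<bar> \<le> \<bar>t k\<bar>) \<Longrightarrow> z + (\<Sum>k\<in>J. \<theta> k *\<^sub>R d k) \<in> S"
  shows "\<bar>f (z + (\<Sum>k\<in>J. t k *\<^sub>R d k)) - f z - (\<Sum>k\<in>J. c k * t k)\<bar> \<le> \<eta> * (\<Sum>k\<in>J. \<bar>t k\<bar>)"
  using assms
proof (induction J rule: finite_induct)
  case empty
  then show ?case by simp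
next
  case (insert j J)
  let ?w = "z + (\<Sum>k\<in>J. t k *\<^sub>R d k)"
  let ?q = "\<lambda>r. f (?w + r *\<^sub>R d j) - c j * r"
  \<comment> \<open>the last leg of the path, in direction \<open>d j\<close>, stays in the box\<close>
  have inS: "?w + r *\<^sub>R d j \<in> S" if "\<bar>r\<bar> \<le> \<bar>t j\<bar>" for r
  proof -
    have "z + (\<Sum>k\<in>insert j J. (if k = j then r else t k) *\<^sub>R d k) \<in> S"
      by (rule insert.prems(2)) (use that in auto)
    moreover have "(\<Sum>k\<in>J. (if k = j then r else t k) *\<^sub>R d k) = (\<Sum>k\<in>J. t k *\<^sub>R d k)"
      by (rule sum.cong) (use insert.hyps in auto)
    ultimately show ?thesis
      using insert.hyps by (simp add: algebra_simps)
  qed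
  have IH: "\<bar>f ?w - f z - (\<Sum>k\<in>J. c k * t k)\<bar> \<le> \<eta> * (\<Sum>k\<in>J. \<bar>t k\<bar>)"
  proof (rule insert.IH)
    fix w k assume "w \<in> S" "k \<in> J"
    then show "\<exists>g. ((\<lambda>r. f (w + r *\<^sub>R d k)) has_real_derivative g) (at 0) \<and> \<bar>g - c k\<bar> \<le> \<eta>"
      using insert.prems(1) by simp
  next
    fix \<theta> :: "'k \<Rightarrow> real" assume le: "\<And>k. k \<in> J \<Longrightarrow> \<bar>\<theta> k\<bar> \<le> \<bar>t k\<bar>"
    have "z + (\<Sum>k\<in>insert j J. (if k = j then 0 else \<theta> k) *\<^sub>R d k) \<in> S"
      by (rule insert.prems(2)) (use le in auto)
    moreover have "(\<Sum>k\<in>J. (if k = j then 0 else \<theta> k) *\<^sub>R d k) = (\<Sum>k\<in>J. \<theta> k *\<^sub>R d k)"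
      by (rule sum.cong) (use insert.hyps in auto)
    ultimately show "z + (\<Sum>k\<in>J. \<theta> k *\<^sub>R d k) \<in> S"
      using insert.hyps by simp
  qed
  have seg: "\<bar>r\<bar> \<le> \<bar>t j\<bar>" if "r \<in> closed_segment 0 (t j)" for r
    using that by (auto simp: closed_segment_eq_real_ivl split: if_splits)
  have "\<exists>g. (?q has_real_derivative g) (at r within closed_segment 0 (t j)) \<and> norm g \<le> \<eta>"
    if r: "r \<in> closed_segment 0 (t j)" for r
  proof -
    obtain g where g: "((\<lambda>a. f (?w + r *\<^sub>R d j + a *\<^sub>R d j)) has_real_derivative g) (at 0)"
      and gc: "\<bar>g - c j\<bar> \<le> \<eta>"
      using insert.prems(1)[OF inS[OF seg[OF r]]] by blast
    have "((\<lambda>a. f (?w + a *\<^sub>R d j)) has_real_derivative g) (at (0 + r))"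
      by (subst DERIV_shift) (use g in \<open>simp add: algebra_simps\<close>)
    then have "(?q has_real_derivative g - c j) (at r)"
      by (auto intro!: derivative_eq_intros)
    then show ?thesis
      using gc has_field_derivative_at_within by fastforce
  qed
  then obtain q' where q': "\<And>r. r \<in> closed_segment 0 (t j) \<Longrightarrow>
      (?q has_real_derivative q' r) (at r within closed_segment 0 (t j)) \<and> norm (q' r) \<le> \<eta>"
    by metis
  have "norm (?q (t j) - ?q 0) \<le> \<eta> * norm (t j - 0)"
    by (rule field_differentiable_bound[where S="closed_segment 0 (t j)"]) (use q' in auto)
  then have "\<bar>f (?w + t j *\<^sub>R d j) - f ?w - c j * t j\<bar> \<le> \<eta> * \<bar>t j\<bar>"
    by (simp add: algebra_simps)
  moreover have "z + (\<Sum>k\<in>insert j J. t k *\<^sub>R d k) = ?w + t j *\<^sub>R d j"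
    using insert.hyps by (simp add: algebra_simps)
  ultimately show ?case
    using IH insert.hyps by (simp add: algebra_simps)
qed

lemma sym_unit_eq: "sym_unit i j = (1/2) *\<^sub>R (axis i (axis j 1) + axis j (axis i 1))"
  by (auto simp: sym_unit_def vec_eq_iff axis_def)

lemma sym_unit_nth:
  "sym_unit i j $ k $ l = ((if k = i \<and> l = j then 1 else 0) + (if k = j \<and> l = i then 1 else 0)) / 2"
  by (simp add: sym_unit_def)

lemma norm_sym_unit_le: "norm (sym_unit i j :: real^'n^'n) \<le> 1"
proof -
  have "norm (axis i (axis j 1) + axis j (axis i 1) :: real^'n^'n) \<le> 1 + 1"
    by (intro norm_triangle_mono order_eq_refl norm_Basis axis_in_Basis_iff[THEN iffD2]) simp_all
  then show ?thesis by (simp add: sym_unit_eq)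
qed

lemma sym_unit_symmetric: "sym_unit i j \<in> sym_mats"
  by (simp add: sym_unit_def sym_mats_def transpose_def vec_eq_iff conj_commute add.commute)

lemma sym_mats_add: "M \<in> sym_mats \<Longrightarrow> N \<in> sym_mats \<Longrightarrow> M + N \<in> sym_mats"
  by (simp add: sym_mats_def transpose_def vec_eq_iff)

lemma sym_mats_scaleR: "M \<in> sym_mats \<Longrightarrow> r *\<^sub>R M \<in> sym_mats"
  by (simp add: sym_mats_def transpose_def vec_eq_iff)

lemma sym_mats_sum: "(\<And>k. k \<in> J \<Longrightarrow> f k \<in> sym_mats) \<Longrightarrow> (\<Sum>k\<in>J. f k) \<in> sym_mats"
proof (induction J rule: infinite_finite_induct)
  case (insert k J)
  then show ?case by (simp add: sym_mats_add)
qed (simp_all add: sym_mats_def transpose_def vec_eq_iff)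

text \<open>
  All pairs $(i,j)$ are summed over, so that an off-diagonal entry is contributed in two halves; the
  diagonal positions, where these two halves fall together, have to be treated apart.
\<close>

lemma sym_unit_expansion:
  fixes N :: "real^'n^'n"
  assumes "N \<in> sym_mats"
  shows "(\<Sum>k\<in>UNIV. N $ fst k $ snd k *\<^sub>R sym_unit (fst k) (snd k)) = N"
proof -
  have "(\<Sum>k\<in>UNIV. N $ fst k $ snd k *\<^sub>R sym_unit (fst k) (snd k)) $ a $ b = N $ a $ b" for a b
  proof -
    have "(\<Sum>k\<in>UNIV. N $ fst k $ snd k *\<^sub>R sym_unit (fst k) (snd k)) $ a $ b =
      (\<Sum>k\<in>UNIV. (if k = (a,b) then N $ a $ b / 2 else 0) + (if k = (b,a) then N $ b $ a / 2 else 0))"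
    proof (unfold sum_component, rule sum.cong)
      fix k :: "'n \<times> 'n"
      show "(N $ fst k $ snd k *\<^sub>R sym_unit (fst k) (snd k)) $ a $ b =
        (if k = (a,b) then N $ a $ b / 2 else 0) + (if k = (b,a) then N $ b $ a / 2 else 0)"
        unfolding vector_scaleR_component sym_unit_nth real_scaleR_def
      proof (cases "a = b")
        case True
        then show "N $ fst k $ snd k * (((if a = fst k \<and> b = snd k then 1 else 0)
            + (if a = snd k \<and> b = fst k then 1 else 0)) / 2) =
          (if k = (a,b) then N $ a $ b / 2 else 0) + (if k = (b,a) then N $ b $ a / 2 else 0)"
          by (cases "k = (b,b)"; cases k) auto
      next
        case False
        then show "N $ fst k $ snd k * (((if a = fst k \<and> b = snd k then 1 else 0)
            + (if a = snd k \<and> b = fst k then 1 else 0)) / 2) =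
          (if k = (a,b) then N $ a $ b / 2 else 0) + (if k = (b,a) then N $ b $ a / 2 else 0)"
          by (cases "k = (a,b)"; cases k) auto
      qed
    qed simp
    also have "\<dots> = N $ a $ b / 2 + N $ b $ a / 2" by (simp add: sum.distrib)
    also have "N $ b $ a = N $ a $ b"
      using assms by (simp add: sym_mats_def transpose_def vec_eq_iff)
    finally show ?thesis by simp
  qed
  then show ?thesis by (simp add: vec_eq_iff)
qed

lemma inner_matrix_sum: "A \<bullet> N = (\<Sum>k\<in>UNIV. A $ fst k $ snd k * N $ fst k $ snd k)"
  for A N :: "real^'n^'n"
  by (simp add: inner_vec_def sum.cartesian_product case_prod_unfold)

lemma sum_abs_vec_le: "(\<Sum>i\<in>UNIV. \<bar>x $ i\<bar>) \<le> CARD('n) * norm x" for x :: "real^'n"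
  using sum_bounded_above[of UNIV "\<lambda>i. \<bar>x $ i\<bar>" "norm x"] component_le_norm_cart by auto

lemma sum_abs_matrix_le:
  "(\<Sum>k\<in>UNIV. \<bar>N $ fst k $ snd k\<bar>) \<le> CARD('n \<times> 'n) * norm N" for N :: "real^'n^'n"
  using sum_bounded_above[of UNIV "\<lambda>k. \<bar>N $ fst k $ snd k\<bar>" "norm N"]
    order_trans[OF component_le_norm_cart Finite_Cartesian_Product.norm_nth_le] by fastforce

text \<open>
  Strict differentiability of $F$ in $(s,p,M)$, with $x$ also allowed to vary: the differential at the base jet
  serves for increments between any two nearby jets over the same point.  The matrix increment is
  compared in the inner product of matrices, $A \bullet N = \sum_{ij} A_{ij} N_{ij}$.  The proof changes $M$, $p$ and
  $s$ in turn, each along its coordinate directions, where continuity of the partials pins the slopes.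
\<close>

lemma operator_linearisation:
  fixes F :: "'n::finite operator"
  assumes C1: "C1_in_spM \<Omega> F" and x0: "x0 \<in> \<Omega>" "M0 \<in> sym_mats" and \<eta>: "\<eta> > 0"
  obtains \<delta> where "\<delta> > 0"
    "\<And>x s p M \<tau> \<pi> N. \<lbrakk>x \<in> \<Omega>; M \<in> sym_mats; N \<in> sym_mats; dist (x,s,p,M) (x0,s0,p0,M0) < \<delta>;
        \<bar>\<tau>\<bar> + norm \<pi> + norm N < \<delta>\<rbrakk> \<Longrightarrow>
       \<bar>F x (s + \<tau>) (p + \<pi>) (M + N) - F x s p M
          - (F_s F x0 s0 p0 M0 * \<tau> + F_p F x0 s0 p0 M0 \<bullet> \<pi> + F_M F x0 s0 p0 M0 \<bullet> N)\<bar>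
        \<le> \<eta> * (\<bar>\<tau>\<bar> + norm \<pi> + norm N)"
proof -
  let ?z0 = "(x0,s0,p0,M0)"
  let ?c = "F_s F x0 s0 p0 M0" and ?b = "F_p F x0 s0 p0 M0" and ?A = "F_M F x0 s0 p0 M0"
  \<comment> \<open>comparison constant between the norms and the $l^1$ norms in which increments along directions are measured\<close>
  define m :: real where "m = CARD('n \<times> 'n)"
  have "1 \<le> CARD('n)" by (simp add: Suc_leI)
  then have m: "m \<ge> 1" "CARD('n) \<le> m"
    unfolding m_def card_prod of_nat_mult
    using mult_mono[of 1 "real CARD('n)" 1 "real CARD('n)"] by simp_all
  define \<kappa> where "\<kappa> = \<eta> / m"
  have \<kappa>: "\<kappa> > 0" "\<kappa> * m = \<eta>" "\<kappa> \<le> \<eta>" using \<eta> m by (auto simp: \<kappa>_def field_simps)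
  have z0: "?z0 \<in> op_dom \<Omega>" using x0 by (simp add: op_dom_def)
  have cont: "\<exists>d>0. \<forall>z\<in>op_dom \<Omega>. dist z ?z0 < d \<longrightarrow> dist (G z) (G ?z0) < \<kappa>"
    if "continuous_on (op_dom \<Omega>) G" for G :: "_ \<Rightarrow> 'b::metric_space"
    using that z0 \<kappa>(1) unfolding continuous_on_iff by blast
  obtain d1 where d1: "d1 > 0" "\<And>x s p M. (x,s,p,M) \<in> op_dom \<Omega> \<Longrightarrow> dist (x,s,p,M) ?z0 < d1 \<Longrightarrow>
      dist (F_s F x s p M) ?c < \<kappa>"
    using cont[of "\<lambda>(x,s,p,M). F_s F x s p M"] C1 unfolding C1_in_spM_def by force
  obtain d2 where d2: "d2 > 0" "\<And>x s p M. (x,s,p,M) \<in> op_dom \<Omega> \<Longrightarrow> dist (x,s,p,M) ?z0 < d2 \<Longrightarrow>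
      dist (F_p F x s p M) ?b < \<kappa>"
    using cont[of "\<lambda>(x,s,p,M). F_p F x s p M"] C1 unfolding C1_in_spM_def by force
  obtain d3 where d3: "d3 > 0" "\<And>x s p M. (x,s,p,M) \<in> op_dom \<Omega> \<Longrightarrow> dist (x,s,p,M) ?z0 < d3 \<Longrightarrow>
      dist (F_M F x s p M) ?A < \<kappa>"
    using cont[of "\<lambda>(x,s,p,M). F_M F x s p M"] C1 unfolding C1_in_spM_def by force
  define \<delta>0 where "\<delta>0 = min d1 (min d2 d3)"
  define \<delta> where "\<delta> = \<delta>0 / (2 * m)"
  have \<delta>0: "\<delta>0 > 0" using d1 d2 d3 by (simp add: \<delta>0_def)
  have \<delta>: "\<delta> > 0" "m * \<delta> = \<delta>0 / 2" "\<delta> \<le> \<delta>0 / 2"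
    using \<delta>0 m by (auto simp: \<delta>_def field_simps)
  show ?thesis
  proof (rule that[OF \<delta>(1)])
    fix x \<pi> p :: "real^'n" and s \<tau> :: real and M N :: "real^'n^'n"
    assume x: "x \<in> \<Omega>" and M: "M \<in> sym_mats" and N: "N \<in> sym_mats"
      and near: "dist (x,s,p,M) ?z0 < \<delta>" and small: "\<bar>\<tau>\<bar> + norm \<pi> + norm N < \<delta>"
    let ?l = "\<bar>\<tau>\<bar> + (\<Sum>i\<in>UNIV. \<bar>\<pi> $ i\<bar>) + (\<Sum>k\<in>UNIV. \<bar>N $ fst k $ snd k\<bar>)"
    have l: "?l \<le> m * (\<bar>\<tau>\<bar> + norm \<pi> + norm N)"
    proof -
      have "1 * \<bar>\<tau>\<bar> \<le> m * \<bar>\<tau>\<bar>" using m by (intro mult_right_mono) auto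
      moreover have "(\<Sum>i\<in>UNIV. \<bar>\<pi> $ i\<bar>) \<le> m * norm \<pi>"
        using sum_abs_vec_le[of \<pi>] mult_right_mono[OF m(2), of "norm \<pi>"] by simp
      moreover have "(\<Sum>k\<in>UNIV. \<bar>N $ fst k $ snd k\<bar>) \<le> m * norm N"
        using sum_abs_matrix_le[of N] by (simp add: m_def)
      ultimately show ?thesis by (simp add: algebra_simps)
    qed
    have "m * (\<bar>\<tau>\<bar> + norm \<pi> + norm N) < m * \<delta>"
      using small m by (intro mult_strict_left_mono) auto
    with l \<delta>(2) have l': "?l < \<delta>0 / 2" by linarith
    \<comment> \<open>the whole coordinate path from $(s,p,M)$ stays in the region where the partials are known\<close>
    have path: "dist (x, s + a, p + q, M + K) ?z0 < \<delta>0"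
      if "\<bar>a\<bar> \<le> \<bar>\<tau>\<bar>" "norm q \<le> (\<Sum>i\<in>UNIV. \<bar>\<pi> $ i\<bar>)" "norm K \<le> (\<Sum>k\<in>UNIV. \<bar>N $ fst k $ snd k\<bar>)"
      for a q K
    proof -
      have "dist (x, s + a, p + q, M + K) (x,s,p,M) = norm (0::real^'n, a, q, K)"
        by (simp add: dist_norm)
      also have "\<dots> \<le> norm (0::real^'n) + (norm a + (norm q + norm K))"
        by (intro order_trans[OF norm_Pair_le] add_mono order_refl)
      also have "\<dots> \<le> ?l" using that by simp
      finally have "dist (x, s + a, p + q, M + K) (x,s,p,M) < \<delta>0 / 2" using l' by linarith
      then show ?thesis
        using dist_triangle[of "(x, s + a, p + q, M + K)" ?z0 "(x,s,p,M)"] near \<delta>(3) by linarith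
    qed
    have dom: "(x, s', p', M') \<in> op_dom \<Omega>" if "M' \<in> sym_mats" for s' p' M'
      using that x by (simp add: op_dom_def)
    have diff:
      "(\<lambda>t. F x t p' M') field_differentiable (at s')"
      "(\<lambda>t. F x s' (p' + t *\<^sub>R axis i 1) M') field_differentiable (at 0)"
      "(\<lambda>t. F x s' p' (M' + t *\<^sub>R sym_unit i j)) field_differentiable (at 0)"
      if "M' \<in> sym_mats" for s' p' M' i j
      using C1 dom[OF that, of s' p'] unfolding C1_in_spM_def by fastforce+
    have MN: "M + N \<in> sym_mats" using M N by (rule sym_mats_add)

    have "\<bar>F x (s + (\<Sum>k\<in>{()}. \<tau> *\<^sub>R 1)) (p + \<pi>) (M + N) - F x s (p + \<pi>) (M + N)
        - (\<Sum>k\<in>{()}. ?c * \<tau>)\<bar> \<le> \<kappa> * (\<Sum>k\<in>{()}. \<bar>\<tau>\<bar>)"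
    proof (rule increment_along_directions[where f="\<lambda>s'. F x s' (p + \<pi>) (M + N)"
          and S="{s'. dist (x, s', p + \<pi>, M + N) ?z0 < \<delta>0}"])
      fix w :: real and k :: unit
      assume w: "w \<in> {s'. dist (x, s', p + \<pi>, M + N) ?z0 < \<delta>0}"
      have "((\<lambda>r. F x r (p + \<pi>) (M + N)) has_real_derivative F_s F x w (p + \<pi>) (M + N)) (at (0 + w))"
        unfolding F_s_def using diff(1)[OF MN] by (simp add: DERIV_deriv_iff_field_differentiable)
      then have "((\<lambda>r. F x (w + r *\<^sub>R 1) (p + \<pi>) (M + N)) has_real_derivative
          F_s F x w (p + \<pi>) (M + N)) (at 0)"
        by (subst (asm) DERIV_shift) (simp add: add.commute)
      moreover have "\<bar>F_s F x w (p + \<pi>) (M + N) - ?c\<bar> \<le> \<kappa>"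
        using d1(2)[OF dom[OF MN]] w by (force simp: \<delta>0_def dist_real_def)
      ultimately show "\<exists>g. ((\<lambda>r. F x (w + r *\<^sub>R 1) (p + \<pi>) (M + N)) has_real_derivative g) (at 0)
          \<and> \<bar>g - ?c\<bar> \<le> \<kappa>" by blast
    next
      fix \<theta> :: "unit \<Rightarrow> real" assume \<theta>: "\<And>k. k \<in> {()} \<Longrightarrow> \<bar>\<theta> k\<bar> \<le> \<bar>\<tau>\<bar>"
      have "norm \<pi> \<le> (\<Sum>i\<in>UNIV. \<bar>\<pi> $ i\<bar>)" by (rule norm_le_l1_cart)
      moreover have "norm (\<Sum>k\<in>UNIV. N $ fst k $ snd k *\<^sub>R sym_unit (fst k) (snd k))
          \<le> (\<Sum>k\<in>UNIV. \<bar>N $ fst k $ snd k\<bar>)"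
        by (rule order_trans[OF norm_sum] sum_mono)+ (simp add: mult_left_le norm_sym_unit_le)
      ultimately show "s + (\<Sum>k\<in>{()}. \<theta> k *\<^sub>R 1) \<in> {s'. dist (x, s', p + \<pi>, M + N) ?z0 < \<delta>0}"
        using path[of "\<theta> ()" \<pi> N] \<theta> by (simp add: sym_unit_expansion[OF N])
    qed simp
    then have 1: "\<bar>F x (s + \<tau>) (p + \<pi>) (M + N) - F x s (p + \<pi>) (M + N) - ?c * \<tau>\<bar> \<le> \<kappa> * \<bar>\<tau>\<bar>"
      by simp

    have "\<bar>F x s (p + (\<Sum>i\<in>UNIV. (\<pi> $ i) *\<^sub>R axis i 1)) (M + N) - F x s p (M + N)
        - (\<Sum>i\<in>UNIV. ?b $ i * \<pi> $ i)\<bar> \<le> \<kappa> * (\<Sum>i\<in>UNIV. \<bar>\<pi> $ i\<bar>)"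
    proof (rule increment_along_directions[where f="\<lambda>p'. F x s p' (M + N)"
          and S="{p'. dist (x, s, p', M + N) ?z0 < \<delta>0}"])
      fix w k
      assume w: "w \<in> {p'. dist (x, s, p', M + N) ?z0 < \<delta>0}"
      have "((\<lambda>r. F x s (w + r *\<^sub>R axis k 1) (M + N)) has_real_derivative F_p F x s w (M + N) $ k) (at 0)"
        using diff(2)[OF MN] by (simp add: F_p_def DERIV_deriv_iff_field_differentiable)
      moreover have "\<bar>F_p F x s w (M + N) $ k - ?b $ k\<bar> \<le> \<kappa>"
      proof -
        have "\<bar>(F_p F x s w (M + N) - ?b) $ k\<bar> \<le> dist (F_p F x s w (M + N)) ?b"
          unfolding dist_norm by (rule component_le_norm_cart)
        moreover have "dist (F_p F x s w (M + N)) ?b < \<kappa>"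
          using d2(2)[OF dom[OF MN]] w by (force simp: \<delta>0_def)
        ultimately show ?thesis by simp
      qed
      ultimately show "\<exists>g. ((\<lambda>r. F x s (w + r *\<^sub>R axis k 1) (M + N)) has_real_derivative g) (at 0)
          \<and> \<bar>g - ?b $ k\<bar> \<le> \<kappa>" by blast
    next
      fix \<theta> :: "'n \<Rightarrow> real" assume \<theta>: "\<And>k. k \<in> UNIV \<Longrightarrow> \<bar>\<theta> k\<bar> \<le> \<bar>\<pi> $ k\<bar>"
      have "norm (\<Sum>k\<in>UNIV. \<theta> k *\<^sub>R (axis k 1 :: real^'n)) \<le> (\<Sum>i\<in>UNIV. \<bar>\<pi> $ i\<bar>)"
        by (rule order_trans[OF norm_sum] sum_mono)+ (use \<theta> in simp)
      moreover have "norm (\<Sum>k\<in>UNIV. N $ fst k $ snd k *\<^sub>R sym_unit (fst k) (snd k))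
          \<le> (\<Sum>k\<in>UNIV. \<bar>N $ fst k $ snd k\<bar>)"
        by (rule order_trans[OF norm_sum] sum_mono)+ (simp add: mult_left_le norm_sym_unit_le)
      ultimately show "p + (\<Sum>k\<in>UNIV. \<theta> k *\<^sub>R axis k 1) \<in> {p'. dist (x, s, p', M + N) ?z0 < \<delta>0}"
        using path[of 0 "\<Sum>k\<in>UNIV. \<theta> k *\<^sub>R axis k 1" N] by (simp add: sym_unit_expansion[OF N])
    qed simp
    moreover have "(\<Sum>i\<in>UNIV. (\<pi> $ i) *\<^sub>R axis i 1) = \<pi>"
      using basis_expansion[of \<pi>] by (simp add: scalar_mult_eq_scaleR)
    moreover have "(\<Sum>i\<in>UNIV. ?b $ i * \<pi> $ i) = ?b \<bullet> \<pi>" by (simp add: inner_vec_def)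
    ultimately have 2: "\<bar>F x s (p + \<pi>) (M + N) - F x s p (M + N) - ?b \<bullet> \<pi>\<bar>
        \<le> \<kappa> * (\<Sum>i\<in>UNIV. \<bar>\<pi> $ i\<bar>)" by simp

    have "\<bar>F x s p (M + (\<Sum>k\<in>UNIV. (N $ fst k $ snd k) *\<^sub>R sym_unit (fst k) (snd k))) - F x s p M
        - (\<Sum>k\<in>UNIV. ?A $ fst k $ snd k * N $ fst k $ snd k)\<bar> \<le> \<kappa> * (\<Sum>k\<in>UNIV. \<bar>N $ fst k $ snd k\<bar>)"
    proof (rule increment_along_directions[where f="\<lambda>M'. F x s p M'"
          and S="{M' \<in> sym_mats. dist (x, s, p, M') ?z0 < \<delta>0}"])
      fix w and k :: "'n \<times> 'n"
      assume w: "w \<in> {M' \<in> sym_mats. dist (x, s, p, M') ?z0 < \<delta>0}"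
      then have ws: "w \<in> sym_mats" by simp
      have "((\<lambda>r. F x s p (w + r *\<^sub>R sym_unit (fst k) (snd k))) has_real_derivative
          F_M F x s p w $ fst k $ snd k) (at 0)"
        using diff(3)[OF ws] by (simp add: F_M_def DERIV_deriv_iff_field_differentiable)
      moreover have "\<bar>F_M F x s p w $ fst k $ snd k - ?A $ fst k $ snd k\<bar> \<le> \<kappa>"
      proof -
        have "\<bar>(F_M F x s p w - ?A) $ fst k $ snd k\<bar> \<le> dist (F_M F x s p w) ?A"
          unfolding dist_norm
          by (rule order_trans[OF component_le_norm_cart Finite_Cartesian_Product.norm_nth_le])
        moreover have "dist (F_M F x s p w) ?A < \<kappa>"
          using d3(2)[OF dom[OF ws]] w by (force simp: \<delta>0_def)
        ultimately show ?thesis by simp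
      qed
      ultimately show "\<exists>g. ((\<lambda>r. F x s p (w + r *\<^sub>R sym_unit (fst k) (snd k))) has_real_derivative g) (at 0)
          \<and> \<bar>g - ?A $ fst k $ snd k\<bar> \<le> \<kappa>" by blast
    next
      fix \<theta> :: "'n \<times> 'n \<Rightarrow> real" assume \<theta>: "\<And>k. k \<in> UNIV \<Longrightarrow> \<bar>\<theta> k\<bar> \<le> \<bar>N $ fst k $ snd k\<bar>"
      have "norm (\<theta> k *\<^sub>R (sym_unit (fst k) (snd k) :: real^'n^'n)) \<le> \<bar>N $ fst k $ snd k\<bar>" for k
      proof -
        have "\<bar>\<theta> k\<bar> * norm (sym_unit (fst k) (snd k) :: real^'n^'n) \<le> \<bar>N $ fst k $ snd k\<bar> * 1"
          using \<theta>[of k] by (intro mult_mono norm_sym_unit_le) auto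
        then show ?thesis by simp
      qed
      then have "norm (\<Sum>k\<in>UNIV. \<theta> k *\<^sub>R (sym_unit (fst k) (snd k) :: real^'n^'n))
          \<le> (\<Sum>k\<in>UNIV. \<bar>N $ fst k $ snd k\<bar>)"
        by (intro order_trans[OF norm_sum] sum_mono)
      then have "dist (x, s, p, M + (\<Sum>k\<in>UNIV. \<theta> k *\<^sub>R sym_unit (fst k) (snd k))) ?z0 < \<delta>0"
        using path[of 0 0 "\<Sum>k\<in>UNIV. \<theta> k *\<^sub>R sym_unit (fst k) (snd k)"] by (simp add: sum_nonneg)
      moreover have "M + (\<Sum>k\<in>UNIV. \<theta> k *\<^sub>R sym_unit (fst k) (snd k)) \<in> sym_mats"
        by (intro sym_mats_add M sym_mats_sum sym_mats_scaleR sym_unit_symmetric)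
      ultimately show "M + (\<Sum>k\<in>UNIV. \<theta> k *\<^sub>R sym_unit (fst k) (snd k))
          \<in> {M' \<in> sym_mats. dist (x, s, p, M') ?z0 < \<delta>0}" by simp
    qed simp
    then have 3: "\<bar>F x s p (M + N) - F x s p M - ?A \<bullet> N\<bar> \<le> \<kappa> * (\<Sum>k\<in>UNIV. \<bar>N $ fst k $ snd k\<bar>)"
      by (simp only: sym_unit_expansion[OF N] inner_matrix_sum)

    have "\<kappa> * ?l \<le> \<kappa> * (m * (\<bar>\<tau>\<bar> + norm \<pi> + norm N))"
      using l \<kappa>(1) by (intro mult_left_mono) auto
    also have "\<dots> = \<eta> * (\<bar>\<tau>\<bar> + norm \<pi> + norm N)" using \<kappa>(2) by (simp add: mult.assoc[symmetric])
    finally have "\<kappa> * \<bar>\<tau>\<bar> + \<kappa> * (\<Sum>i\<in>UNIV. \<bar>\<pi> $ i\<bar>) + \<kappa> * (\<Sum>k\<in>UNIV. \<bar>N $ fst k $ snd k\<bar>)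
        \<le> \<eta> * (\<bar>\<tau>\<bar> + norm \<pi> + norm N)"
      by (simp only: distrib_left)
    then show "\<bar>F x (s + \<tau>) (p + \<pi>) (M + N) - F x s p M - (?c * \<tau> + ?b \<bullet> \<pi> + ?A \<bullet> N)\<bar>
        \<le> \<eta> * (\<bar>\<tau>\<bar> + norm \<pi> + norm N)"
      using 1 2 3 by (smt (verit))
  qed
qed

section \<open>The barrier at a boundary point of a ball\<close>

text \<open>
  Coordinates are centred at the touching point and $e$ points from there to the centre of the
  touching ball.  The set where $\mathrm{cap} \ge 0$ is the closed ball with diameter from $0$ to $e$.
  It meets the touching sphere at $0$ only, so that on the rest of it $u > v$ is known.
\<close>

definition cap :: "real^'n \<Rightarrow> real^'n \<Rightarrow> real" where
  "cap e z = z \<bullet> e - z \<bullet> z"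

definition outer :: "real^'n \<Rightarrow> real^'n \<Rightarrow> real^'n^'n" where
  "outer a b = (\<chi> i j. a $ i * b $ j)"

text \<open>
  Near $0$ this has the sign of the cap function, since it equals $\mathrm{cap} \cdot (1 + a\, \mathrm{cap})$.  The quadratic term
  leaves the gradient at $0$ equal to $e$ and adds $2 a\, e e^T$ to the second derivative there, so its
  coefficient $a$ tunes the value of an elliptic operator at $0$.
\<close>

definition barrier :: "real \<Rightarrow> real^'n \<Rightarrow> real^'n \<Rightarrow> real" where
  "barrier a e z = cap e z + a * (cap e z)\<^sup>2"

definition barrier_grad :: "real \<Rightarrow> real^'n \<Rightarrow> real^'n \<Rightarrow> real^'n" where
  "barrier_grad a e z = (1 + 2 * a * cap e z) *\<^sub>R (e - 2 *\<^sub>R z)"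

definition barrier_hess :: "real \<Rightarrow> real^'n \<Rightarrow> real^'n \<Rightarrow> real^'n^'n" where
  "barrier_hess a e z = (- 2 * (1 + 2 * a * cap e z)) *\<^sub>R mat 1
     + (2 * a) *\<^sub>R outer (e - 2 *\<^sub>R z) (e - 2 *\<^sub>R z)"

lemma outer_mult_vec: "outer a b *v y = (b \<bullet> y) *\<^sub>R a"
  by (simp add: outer_def matrix_vector_mult_def vec_eq_iff inner_vec_def sum_distrib_left mult_ac)

lemma inner_outer: "A \<bullet> outer e e = e \<bullet> (A *v e)"
  by (simp add: outer_def matrix_vector_mult_def inner_vec_def sum_distrib_left mult_ac)

lemma cap_pos_imp_in_ball:
  assumes "z \<noteq> 0" "0 \<le> cap e z"
  shows "norm (z - e) < norm e"
proof -
  have "(norm (z - e))\<^sup>2 = (norm e)\<^sup>2 - 2 * cap e z - z \<bullet> z"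
    by (simp add: cap_def power2_norm_eq_inner inner_diff_left inner_diff_right inner_commute)
  moreover have "z \<bullet> z > 0" using assms(1) by simp
  ultimately have "(norm (z - e))\<^sup>2 < (norm e)\<^sup>2" using assms(2) by linarith
  then show ?thesis by (simp add: power_less_imp_less_base)
qed

lemma barrier_hess_mult_vec:
  "barrier_hess a e z *v y = (1 + 2 * a * cap e z) *\<^sub>R - (2 *\<^sub>R y)
     + (2 * a * ((e - 2 *\<^sub>R z) \<bullet> y)) *\<^sub>R (e - 2 *\<^sub>R z)"
proof -
  have "barrier_hess a e z *v y = ((- 2 * (1 + 2 * a * cap e z)) *\<^sub>R mat 1) *v y
      + ((2 * a) *\<^sub>R outer (e - 2 *\<^sub>R z) (e - 2 *\<^sub>R z)) *v y"
    unfolding barrier_hess_def by (rule matrix_vector_mult_add_rdistrib)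
  moreover have "(- 2 * (1 + 2 * a * cap e z)) *\<^sub>R y = (1 + 2 * a * cap e z) *\<^sub>R - (2 *\<^sub>R y)"
    by (simp only: scaleR_minus_right scaleR_scaleR scaleR_minus_left[symmetric] mult.commute mult_minus_left)
  ultimately show ?thesis
    by (simp only: scaleR_matrix_vector_assoc[symmetric] outer_mult_vec matrix_vector_mul_lid scaleR_scaleR)
qed

lemma has_derivative_barrier:
  "(barrier a e has_derivative (\<lambda>y. barrier_grad a e z \<bullet> y)) (at z)"
  "(barrier_grad a e has_derivative (\<lambda>y. barrier_hess a e z *v y)) (at z)"
proof -
  have c: "(cap e has_derivative (\<lambda>y. (e - 2 *\<^sub>R z) \<bullet> y)) (at z)"
    unfolding cap_def[abs_def]
    by (auto intro!: derivative_eq_intros simp: algebra_simps inner_commute)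
  show "(barrier a e has_derivative (\<lambda>y. barrier_grad a e z \<bullet> y)) (at z)"
    unfolding barrier_def[abs_def] barrier_grad_def
    by (rule has_derivative_eq_rhs[OF has_derivative_add[OF c
          has_derivative_mult_right[OF has_derivative_power[OF c, of 2]]]])
      (simp add: fun_eq_iff algebra_simps)
  show "(barrier_grad a e has_derivative (\<lambda>y. barrier_hess a e z *v y)) (at z)"
    unfolding barrier_grad_def[abs_def]
    by (rule has_derivative_eq_rhs[OF has_derivative_scaleR[OF
          has_derivative_add[OF has_derivative_const has_derivative_mult_right[OF c]]
          has_derivative_diff[OF has_derivative_const has_derivative_scaleR_right[OF has_derivative_ident]]]])
      (simp add: fun_eq_iff barrier_hess_mult_vec)
qed

lemma barrier_hess_symmetric: "barrier_hess a e z \<in> sym_mats"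
proof -
  have "outer b b \<in> sym_mats" for b :: "real^'n"
    by (simp add: sym_mats_def transpose_def vec_eq_iff outer_def)
  moreover have "mat 1 \<in> sym_mats" by (simp add: sym_mats_def transpose_mat)
  ultimately show ?thesis
    unfolding barrier_hess_def by (intro sym_mats_add sym_mats_scaleR)
qed

lemma continuous_outer [continuous_intros]:
  assumes "continuous_on S f" "continuous_on S g"
  shows "continuous_on S (\<lambda>x. outer (f x) (g x))"
  unfolding outer_def using assms by (intro continuous_intros)

lemma continuous_cap [continuous_intros]:
  "continuous_on S f \<Longrightarrow> continuous_on S (\<lambda>x. cap e (f x))"
  unfolding cap_def by (intro continuous_intros)

lemma continuous_barrier [continuous_intros]:
  assumes f: "continuous_on S f"
  shows "continuous_on S (\<lambda>x. barrier a e (f x))"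
    and "continuous_on S (\<lambda>x. barrier_grad a e (f x))"
    and "continuous_on S (\<lambda>x. barrier_hess a e (f x))"
  unfolding barrier_def barrier_grad_def barrier_hess_def by (intro continuous_intros f)+

lemma C2_on_add_barrier:
  fixes v :: "real^'n \<Rightarrow> real" and e x\<^sub>0 :: "real^'n" and \<epsilon> a m :: real
  assumes v: "C2_on U v" and U: "open U"
  defines "\<phi> \<equiv> \<lambda>x. v x + \<epsilon> * barrier a e (x - x\<^sub>0) + m"
  shows "C2_on U \<phi>"
    and "\<And>x. x \<in> U \<Longrightarrow> grad \<phi> x = grad v x + \<epsilon> *\<^sub>R barrier_grad a e (x - x\<^sub>0)"
    and "\<And>x. x \<in> U \<Longrightarrow> hess \<phi> x = hess v x + \<epsilon> *\<^sub>R barrier_hess a e (x - x\<^sub>0)"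
proof -
  note D = C2_on_derivatives[OF v U]
  have sh: "((\<lambda>x. x - x\<^sub>0) has_derivative (\<lambda>y. y)) (at x)" for x by (auto intro!: derivative_eq_intros)
  have d1: "(\<phi> has_derivative (\<lambda>y. (grad v x + \<epsilon> *\<^sub>R barrier_grad a e (x - x\<^sub>0)) \<bullet> y)) (at x)"
    if "x \<in> U" for x
    unfolding \<phi>_def
    by (rule has_derivative_eq_rhs[OF has_derivative_add[OF has_derivative_add[OF D(1)[OF that]
          has_derivative_mult_right[OF has_derivative_compose[OF sh has_derivative_barrier(1)]]]
          has_derivative_const]])
      (simp add: inner_left_distrib)
  have d2: "((\<lambda>x. grad v x + \<epsilon> *\<^sub>R barrier_grad a e (x - x\<^sub>0)) has_derivative
      (\<lambda>y. (hess v x + \<epsilon> *\<^sub>R barrier_hess a e (x - x\<^sub>0)) *v y)) (at x)" if "x \<in> U" for x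
    by (rule has_derivative_eq_rhs[OF has_derivative_add[OF D(2)[OF that]
          has_derivative_scaleR_right[OF has_derivative_compose[OF sh has_derivative_barrier(2)]]]])
      (simp add: matrix_vector_mult_add_rdistrib scaleR_matrix_vector_assoc)
  have "continuous_on U (hess v)" using v by (simp add: C2_on_def)
  then have c: "continuous_on U (\<lambda>x. hess v x + \<epsilon> *\<^sub>R barrier_hess a e (x - x\<^sub>0))"
    by (intro continuous_intros)
  note * = C2_onI[OF U d1 d2 c]
  show "C2_on U \<phi>" using *(1) by blast
  show "grad \<phi> x = grad v x + \<epsilon> *\<^sub>R barrier_grad a e (x - x\<^sub>0)" if "x \<in> U" for x
    using *(2) that by blast
  show "hess \<phi> x = hess v x + \<epsilon> *\<^sub>R barrier_hess a e (x - x\<^sub>0)" if "x \<in> U" for x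
    using *(3) that by blast
qed

section \<open>The strong maximum principle\<close>

lemma eventually_nhds_less:
  fixes f g :: "'a::t2_space \<Rightarrow> real"
  assumes "isCont f x" "isCont g x" "f x < g x"
  shows "eventually (\<lambda>y. f y < g y) (nhds x)"
proof -
  have "((\<lambda>y. g y - f y) \<longlongrightarrow> g x - f x) (nhds x)"
    using assms(1,2) unfolding isCont_def tendsto_at_iff_tendsto_nhds by (rule tendsto_diff[rotated])
  then have "eventually (\<lambda>y. 0 < g y - f y) (nhds x)"
    by (rule order_tendstoD) (use assms(3) in simp)
  then show ?thesis by (rule eventually_mono) simp
qed

text \<open>
  The Hopf-type argument described at the beginning: at a point $x_0$ with $u(x_0) = v(x_0)$ there is no
  touching ball on which $u > v$.
\<close>

lemma hopf_no_touching:
  fixes F :: "'n::finite operator" and u v :: "real^'n \<Rightarrow> real"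
  assumes \<Omega>: "open \<Omega>" and C1: "C1_in_spM \<Omega> F" and ell: "elliptic \<Omega> F"
    and u: "lsc_on \<Omega> u" and v: "C2_on \<Omega> v" and le: "\<And>x. x \<in> \<Omega> \<Longrightarrow> v x \<le> u x"
    and visc: "viscosity_le \<Omega> F u v"
    and x0: "x\<^sub>0 \<in> \<Omega>" "u x\<^sub>0 = v x\<^sub>0"
    and ball: "x1 \<noteq> x\<^sub>0" "\<And>x. x \<in> ball x1 (dist x1 x\<^sub>0) \<Longrightarrow> v x < u x"
  shows False
proof -
  define e where "e = x1 - x\<^sub>0"
  have e: "e \<noteq> 0" using ball(1) by (simp add: e_def)
  let ?c = "F_s F x\<^sub>0 (v x\<^sub>0) (grad v x\<^sub>0) (hess v x\<^sub>0)"
  let ?b = "F_p F x\<^sub>0 (v x\<^sub>0) (grad v x\<^sub>0) (hess v x\<^sub>0)"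
  let ?A = "F_M F x\<^sub>0 (v x\<^sub>0) (grad v x\<^sub>0) (hess v x\<^sub>0)"
  have hsym: "hess v x \<in> sym_mats" if "x \<in> \<Omega>" for x by (rule hess_symmetric[OF v \<Omega> that])
  define q where "q = e \<bullet> (?A *v e)"
  have "(x\<^sub>0, v x\<^sub>0, grad v x\<^sub>0, hess v x\<^sub>0) \<in> op_dom \<Omega>"
    using x0(1) hsym by (simp add: op_dom_def)
  then have q: "q > 0" using ell e unfolding elliptic_def pos_def_mat_def q_def by blast
  \<comment> \<open>this choice makes the first and second order part of the linearisation equal to 1 on the barrier at \<open>x\<^sub>0\<close>\<close>
  define a where "a = (1 + 2 * (?A \<bullet> mat 1) - ?b \<bullet> e) / (2 * q)"
  define h where "h x = barrier a e (x - x\<^sub>0)" for x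
  define g where "g x = barrier_grad a e (x - x\<^sub>0)" for x
  define H where "H x = barrier_hess a e (x - x\<^sub>0)" for x
  have h0: "h x\<^sub>0 = 0" and g0: "g x\<^sub>0 = e" by (simp_all add: h_def g_def barrier_def barrier_grad_def cap_def)
  have H0: "H x\<^sub>0 = - 2 *\<^sub>R mat 1 + (2 * a) *\<^sub>R outer e e" by (simp add: H_def barrier_hess_def cap_def)
  have "2 * q * a = 1 + 2 * (?A \<bullet> mat 1) - ?b \<bullet> e" using q by (simp add: a_def)
  then have one: "?b \<bullet> g x\<^sub>0 + ?A \<bullet> H x\<^sub>0 = 1"
    by (simp add: g0 H0 inner_add_right inner_outer q_def algebra_simps)
  have cont: "continuous_on UNIV h" "continuous_on UNIV g" "continuous_on UNIV H"
    unfolding h_def[abs_def] g_def[abs_def] H_def[abs_def] by (intro continuous_intros)+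
  \<comment> \<open>linearisation error allowed: less than that value 1, relative to the size of the jet of the barrier\<close>
  define \<eta> where "\<eta> = 1 / (2 * (1 + norm e + norm (H x\<^sub>0)))"
  have pos: "1 + norm e + norm (H x\<^sub>0) > 0" by (smt (verit) norm_ge_zero)
  then have \<eta>: "\<eta> > 0" by (simp add: \<eta>_def)
  have "\<eta> * (norm e + norm (H x\<^sub>0)) < \<eta> * (2 * (1 + norm e + norm (H x\<^sub>0)))"
  proof (rule mult_strict_left_mono[OF _ \<eta>])
    show "norm e + norm (H x\<^sub>0) < 2 * (1 + norm e + norm (H x\<^sub>0))"
      using norm_ge_zero[of e] norm_ge_zero[of "H x\<^sub>0"] unfolding distrib_left by linarith
  qed
  also have "\<dots> = 1" using pos by (simp add: \<eta>_def)
  finally have \<eta>1: "\<eta> * (norm e + norm (H x\<^sub>0)) < 1" .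
  \<comment> \<open>\<open>\<epsilon> * P\<close> is a lower bound for the linear part of the increment of $F$, and \<open>\<epsilon> * S\<close> an upper bound for the size of the jet increment\<close>
  define P where "P x = ?b \<bullet> g x + ?A \<bullet> H x - \<bar>?c\<bar> * \<bar>h x\<bar>" for x
  define S where "S x = \<bar>h x\<bar> + norm (g x) + norm (H x)" for x
  have contPS: "continuous_on UNIV P" "continuous_on UNIV S"
    unfolding P_def[abs_def] S_def[abs_def] by (intro continuous_intros cont)+
  have S0: "S x \<ge> 0" for x by (simp add: S_def)
  define B where "B = S x\<^sub>0 + 1"
  have B: "B > 0" using S0[of x\<^sub>0] by (simp add: B_def)
  obtain \<delta> where \<delta>: "\<delta> > 0" and lin:
    "\<And>x s p M \<tau> \<pi> N. \<lbrakk>x \<in> \<Omega>; M \<in> sym_mats; N \<in> sym_mats;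
        dist (x,s,p,M) (x\<^sub>0, v x\<^sub>0, grad v x\<^sub>0, hess v x\<^sub>0) < \<delta>; \<bar>\<tau>\<bar> + norm \<pi> + norm N < \<delta>\<rbrakk> \<Longrightarrow>
       \<bar>F x (s + \<tau>) (p + \<pi>) (M + N) - F x s p M - (?c * \<tau> + ?b \<bullet> \<pi> + ?A \<bullet> N)\<bar>
        \<le> \<eta> * (\<bar>\<tau>\<bar> + norm \<pi> + norm N)"
    using operator_linearisation[OF C1 x0(1) hsym[OF x0(1)] \<eta>, of "v x\<^sub>0" "grad v x\<^sub>0"] by metis
  let ?jet = "\<lambda>x. (x, v x, grad v x, hess v x)"
  have jet: "continuous_on \<Omega> ?jet"
    using v by (intro continuous_intros) (auto simp: C2_on_def differentiable_imp_continuous_on)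
  have at: "isCont f x\<^sub>0" if "continuous_on \<Omega> f" for f :: "real^'n \<Rightarrow> 'b::topological_space"
    using that \<Omega> x0(1) by (simp add: continuous_on_eq_continuous_at)
  have cv: "isCont f x\<^sub>0" if "continuous_on UNIV f" for f :: "real^'n \<Rightarrow> 'b::topological_space"
    using that by (simp add: continuous_on_eq_continuous_at)
  have "eventually (\<lambda>x. x \<in> \<Omega> \<and> \<eta> * S x < P x \<and> S x < B \<and> 0 < 1 + a * cap e (x - x\<^sub>0)
      \<and> dist (?jet x) (?jet x\<^sub>0) < \<delta>) (nhds x\<^sub>0)"
  proof (intro eventually_conj)
    show "eventually (\<lambda>x. x \<in> \<Omega>) (nhds x\<^sub>0)" using \<Omega> x0(1) by (rule eventually_nhds_in_open)
    show "eventually (\<lambda>x. \<eta> * S x < P x) (nhds x\<^sub>0)"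
      using one \<eta>1 by (intro eventually_nhds_less cv continuous_intros contPS)
        (simp add: P_def S_def h0 g0)
    show "eventually (\<lambda>x. S x < B) (nhds x\<^sub>0)"
      by (intro eventually_nhds_less cv continuous_intros contPS) (simp add: B_def)
    show "eventually (\<lambda>x. 0 < 1 + a * cap e (x - x\<^sub>0)) (nhds x\<^sub>0)"
      by (intro eventually_nhds_less cv continuous_intros) (simp add: cap_def)
    show "eventually (\<lambda>x. dist (?jet x) (?jet x\<^sub>0) < \<delta>) (nhds x\<^sub>0)"
      by (intro eventually_nhds_less at continuous_on_dist jet continuous_on_const) (simp add: \<delta>)
  qed
  then obtain r where r: "r > 0" and near: "\<And>x. dist x x\<^sub>0 < r \<Longrightarrow> x \<in> \<Omega> \<and> \<eta> * S x < P x \<and> S x < B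
      \<and> 0 < 1 + a * cap e (x - x\<^sub>0) \<and> dist (?jet x) (?jet x\<^sub>0) < \<delta>"
    unfolding eventually_nhds_metric by blast
  define \<rho> where "\<rho> = r / 2"
  have \<rho>: "\<rho> > 0" "\<And>x. x \<in> cball x\<^sub>0 \<rho> \<Longrightarrow> dist x x\<^sub>0 < r"
    using r by (auto simp: \<rho>_def dist_commute)
  note near = near[OF \<rho>(2)]
  have sub: "cball x\<^sub>0 \<rho> \<subseteq> \<Omega>" using near by blast
  have vc: "continuous_on \<Omega> v" using v by (simp add: C2_on_def differentiable_imp_continuous_on)

  let ?K = "{x \<in> sphere x\<^sub>0 \<rho>. 0 \<le> cap e (x - x\<^sub>0)}"
  have "?K = sphere x\<^sub>0 \<rho> \<inter> {x. 0 \<le> cap e (x - x\<^sub>0)}" by auto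
  moreover have "closed {x. 0 \<le> cap e (x - x\<^sub>0)}"
    by (intro closed_Collect_le continuous_intros)
  ultimately have K: "compact ?K" by (simp add: compact_Int_closed)
  have Ksub: "?K \<subseteq> \<Omega>" using sub by (auto simp: subset_eq)
  have Kpos: "v x < u x" if "x \<in> ?K" for x
  proof (rule ball(2))
    have "norm (x - x\<^sub>0 - e) < norm e"
      using that \<rho>(1) by (intro cap_pos_imp_in_ball) auto
    then show "x \<in> ball x1 (dist x1 x\<^sub>0)" by (simp add: e_def dist_norm norm_minus_commute)
  qed
  \<comment> \<open>on the part of the sphere where the barrier may be positive, $u - v$ is bounded away from 0\<close>
  obtain \<mu> where \<mu>: "\<mu> > 0" "\<And>x. x \<in> ?K \<Longrightarrow> \<mu> \<le> u x - v x"
  proof (cases "?K = {}")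
    case True
    then show ?thesis using that[of 1] by auto
  next
    case False
    have "lsc_on ?K (\<lambda>x. u x - v x)"
      by (rule lsc_on_subset[OF lsc_on_diff_continuous[OF u vc] Ksub])
    then obtain x where "x \<in> ?K" "\<And>y. y \<in> ?K \<Longrightarrow> u x - v x \<le> u y - v y"
      by (rule lsc_on_attains_min[OF _ K False]) blast
    then show ?thesis by (intro that[of "u x - v x"]) (use Kpos[of x] in auto)
  qed
  \<comment> \<open>the bound by \<open>\<mu>\<close> gives positivity on the sphere, the bound by \<open>\<delta>\<close> keeps the jet of the test function in the range of the linearisation\<close>
  define \<epsilon> where "\<epsilon> = min \<mu> \<delta> / (2 * B)"
  have \<epsilon>: "\<epsilon> > 0" using \<mu> \<delta> B by (simp add: \<epsilon>_def)
  have "\<epsilon> * B = min \<mu> \<delta> / 2" using B by (simp add: \<epsilon>_def)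
  then have \<epsilon>B: "\<epsilon> * B < \<mu>" "\<epsilon> * B < \<delta>" using \<mu>(1) \<delta> by auto
  have SB: "\<epsilon> * S x < \<epsilon> * B" if "x \<in> cball x\<^sub>0 \<rho>" for x
    using near[OF that] \<epsilon> by simp
  define w where "w x = u x - (v x + \<epsilon> * h x)" for x
  have "continuous_on \<Omega> h" using cont(1) continuous_on_subset by blast
  then have "continuous_on \<Omega> (\<lambda>x. v x + \<epsilon> * h x)"
    by (intro continuous_on_add vc continuous_on_mult_left)
  then have "lsc_on (cball x\<^sub>0 \<rho>) w"
    unfolding w_def[abs_def] by (rule lsc_on_subset[OF lsc_on_diff_continuous[OF u] sub])
  then obtain y where y: "y \<in> cball x\<^sub>0 \<rho>" "\<And>x. x \<in> cball x\<^sub>0 \<rho> \<Longrightarrow> w y \<le> w x"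
    by (rule lsc_on_attains_min) (use \<rho>(1) in auto)
  have wy: "w y \<le> 0" using y(2)[of x\<^sub>0] \<rho>(1) x0(2) by (simp add: w_def h0)
  have "w x > 0" if "x \<in> sphere x\<^sub>0 \<rho>" for x
  proof (cases "0 \<le> cap e (x - x\<^sub>0)")
    case True
    have "h x \<le> S x"
      using abs_ge_self[of "h x"] norm_ge_zero[of "g x"] norm_ge_zero[of "H x"]
      unfolding S_def by linarith
    then have "\<epsilon> * h x \<le> \<epsilon> * S x" using \<epsilon> by simp
    moreover have "\<epsilon> * S x < \<epsilon> * B" using that by (intro SB) auto
    ultimately show ?thesis using \<mu>(2)[of x] True that \<epsilon>B(1) by (simp add: w_def)
  next
    case False
    have "0 < 1 + a * cap e (x - x\<^sub>0)" using near[of x] that by auto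
    then have "cap e (x - x\<^sub>0) * (1 + a * cap e (x - x\<^sub>0)) < 0" using False by (intro mult_neg_pos) auto
    then have "h x < 0" by (simp add: h_def barrier_def algebra_simps power2_eq_square)
    then have "\<epsilon> * h x < 0" using \<epsilon> by (simp add: mult_pos_neg)
    moreover have "x \<in> \<Omega>" using that sub by (auto simp: subset_eq)
    ultimately show ?thesis using le[of x] by (simp add: w_def)
  qed
  then have "y \<notin> sphere x\<^sub>0 \<rho>" using wy by force
  then have yb: "y \<in> ball x\<^sub>0 \<rho>" using y(1) by auto
  have y\<Omega>: "y \<in> \<Omega>" using y(1) sub by blast
  \<comment> \<open>the height $u - v$ at the contact point; it lies between 0 and \<open>\<epsilon> * h y\<close> because $u \ge v$ and the minimum is not positive\<close>
  define \<tau> where "\<tau> = \<epsilon> * h y + w y"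
  define \<phi> where "\<phi> x = v x + \<epsilon> * barrier a e (x - x\<^sub>0) + w y" for x
  have sub': "ball x\<^sub>0 \<rho> \<subseteq> \<Omega>" using sub by (auto simp: subset_eq)
  have "C2_on (ball x\<^sub>0 \<rho>) v"
    using v sub' by (auto simp: C2_on_def intro: differentiable_on_subset continuous_on_subset)
  note \<phi>C2 = C2_on_add_barrier[OF this open_ball, where \<epsilon>=\<epsilon> and a=a and e=e and x\<^sub>0=x\<^sub>0 and m="w y",
      folded \<phi>_def]
  have \<phi>y: "\<phi> y = u y" "\<phi> y = v y + \<tau>" by (simp_all add: \<phi>_def \<tau>_def w_def h_def)
  have "\<phi> x \<le> u x" if "x \<in> ball x\<^sub>0 \<rho>" for x
    using y(2)[of x] that by (simp add: \<phi>_def w_def h_def)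
  then have "F y (\<phi> y) (grad \<phi> y) (hess \<phi> y) \<le> F y (v y) (grad v y) (hess v y)"
    using visc y\<Omega> yb \<phi>C2(1) \<phi>y(1) sub' unfolding viscosity_le_def by (meson open_ball)
  moreover have "F y (\<phi> y) (grad \<phi> y) (hess \<phi> y)
      = F y (v y + \<tau>) (grad v y + \<epsilon> *\<^sub>R g y) (hess v y + \<epsilon> *\<^sub>R H y)"
    using \<phi>C2(2,3)[OF yb] \<phi>y(2) by (simp add: g_def H_def)
  moreover have "F y (v y + \<tau>) (grad v y + \<epsilon> *\<^sub>R g y) (hess v y + \<epsilon> *\<^sub>R H y) > F y (v y) (grad v y) (hess v y)"
  proof -
    have "\<epsilon> * h y \<le> \<epsilon> * \<bar>h y\<bar>" using \<epsilon> by (intro mult_left_mono) auto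
    then have \<tau>: "0 \<le> \<tau>" "\<tau> \<le> \<epsilon> * \<bar>h y\<bar>"
      using le[OF y\<Omega>] \<phi>y wy unfolding \<tau>_def by linarith+
    then have inc: "\<bar>\<tau>\<bar> + norm (\<epsilon> *\<^sub>R g y) + norm (\<epsilon> *\<^sub>R H y) \<le> \<epsilon> * S y"
      using \<epsilon> by (simp add: S_def algebra_simps)
    have "\<bar>F y (v y + \<tau>) (grad v y + \<epsilon> *\<^sub>R g y) (hess v y + \<epsilon> *\<^sub>R H y) - F y (v y) (grad v y) (hess v y)
        - (?c * \<tau> + ?b \<bullet> (\<epsilon> *\<^sub>R g y) + ?A \<bullet> (\<epsilon> *\<^sub>R H y))\<bar>
      \<le> \<eta> * (\<bar>\<tau>\<bar> + norm (\<epsilon> *\<^sub>R g y) + norm (\<epsilon> *\<^sub>R H y))"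
    proof (rule lin[OF y\<Omega> hsym[OF y\<Omega>]])
      show "\<epsilon> *\<^sub>R H y \<in> sym_mats" unfolding H_def by (intro sym_mats_scaleR barrier_hess_symmetric)
      show "dist (?jet y) (?jet x\<^sub>0) < \<delta>" using near[OF y(1)] by blast
      show "\<bar>\<tau>\<bar> + norm (\<epsilon> *\<^sub>R g y) + norm (\<epsilon> *\<^sub>R H y) < \<delta>"
        using inc SB[OF y(1)] \<epsilon>B(2) by linarith
    qed
    moreover have "\<eta> * (\<bar>\<tau>\<bar> + norm (\<epsilon> *\<^sub>R g y) + norm (\<epsilon> *\<^sub>R H y)) \<le> \<eta> * (\<epsilon> * S y)"
      using inc \<eta> by (intro mult_left_mono) auto
    moreover have "\<eta> * (\<epsilon> * S y) < \<epsilon> * P y"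
    proof -
      have "\<epsilon> * (\<eta> * S y) < \<epsilon> * P y" using near[OF y(1)] \<epsilon> by simp
      then show ?thesis by (simp add: mult.left_commute)
    qed
    moreover have "\<epsilon> * P y \<le> ?c * \<tau> + ?b \<bullet> (\<epsilon> *\<^sub>R g y) + ?A \<bullet> (\<epsilon> *\<^sub>R H y)"
    proof -
      have "\<bar>?c * \<tau>\<bar> \<le> \<bar>?c\<bar> * (\<epsilon> * \<bar>h y\<bar>)" using \<tau> by (simp add: abs_mult mult_left_mono)
      then have "- (\<epsilon> * (\<bar>?c\<bar> * \<bar>h y\<bar>)) \<le> ?c * \<tau>" by (simp add: mult.left_commute abs_le_iff)
      then show ?thesis by (simp add: P_def algebra_simps)
    qed
    ultimately show ?thesis by linarith
  qed
  ultimately show False by linarith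
qed

theorem theorem3p1:
  fixes \<Omega> :: "(real^'n) set"
    and F :: "'n operator"
    and u v :: "real^'n \<Rightarrow> real"
  assumes "open \<Omega>" and "connected \<Omega>"
    and "continuous_on (op_dom \<Omega>) (\<lambda>(x, s, p, M). F x s p M)"
    and "C1_in_spM \<Omega> F"
    and "elliptic \<Omega> F"
    and "lsc_on \<Omega> u"
    and "C2_on \<Omega> v"
    and "\<forall>x\<in>\<Omega>. v x \<le> u x"
    and "viscosity_le \<Omega> F u v"
    and "\<exists>x\<in>\<Omega>. u x = v x"
  shows "\<forall>x\<in>\<Omega>. u x = v x"
proof (rule ccontr)
  assume neq: "\<not> (\<forall>x\<in>\<Omega>. u x = v x)"
  define Z where "Z = {x \<in> \<Omega>. u x = v x}"
  have "continuous_on \<Omega> v"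
    using assms(7) by (simp add: C2_on_def differentiable_imp_continuous_on)
  then have "openin (top_of_set \<Omega>) {x \<in> \<Omega>. 0 < u x - v x}"
    using lsc_on_diff_continuous[OF assms(6)] unfolding lsc_on_def by blast
  moreover have "{x \<in> \<Omega>. 0 < u x - v x} = \<Omega> - Z" using assms(8) by (force simp: Z_def)
  ultimately have "closedin (top_of_set \<Omega>) Z" by (simp add: closedin_def Z_def)
  moreover have "Z \<noteq> {}" "Z \<noteq> \<Omega>" using assms(10) neq by (auto simp: Z_def)
  ultimately obtain x1 x\<^sub>0 where x: "x\<^sub>0 \<in> Z" "x1 \<noteq> x\<^sub>0" "ball x1 (dist x1 x\<^sub>0) \<subseteq> \<Omega> - Z"
    using touching_ball[OF assms(1,2)] by metis
  have "v x < u x" if "x \<in> ball x1 (dist x1 x\<^sub>0)" for x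
    using x(3) that assms(8) by (fastforce simp: Z_def less_le)
  then show False
    using hopf_no_touching[OF assms(1,4,5,6,7) _ assms(9), of x\<^sub>0 x1] assms(8) x(1,2)
    by (auto simp: Z_def)
qed

end
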